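(* Let $(X,d)$ be a compact metric space, let $f_n:X\to X$ be continuous for every $n\ge0$, let $A=(a_{ij})_{N\times N}$ be a transition matrix, and let $\{V_{i,n}\}_{n=0}^\infty$, $1\le i\le N$, be sequences of nonempty closed subsets of $X$. Fix any $m,n\ge0$ and any $\alpha=(a_0,a_1,\dots)\in\Sigma_N^+(A)$. Then $V_\alpha^{m,n}\ne\emptyset$ if and only if $\mathcal H_\alpha^{m,n}\neq\emptyset$, where $$V_\alpha^{m,n}:=\bigcap_{k=0}^{m}f_n^{-k}(V_{a_k,n+k}),\qquad \mathcal H_\alpha^{m,n}:=\bigcap_{k=0}^{m}\bar f_n^{-k}(\langle V_{a_k,n+k}\rangle).$$
   Context: $\mathcal K(X)$ is the set of all nonempty compact subsets of $X$; for nonempty $K\subset X$, $\langle K\rangle:=\{B\in\mathcal K(X):B\subset K\}$; $\bar f_n:\mathcal K(X)\to\mathcal K(X)$ is $\bar f_n(B):=f_n(B)$. For a sequence of maps $g_n$ (here $g_n=f_n$ or $g_n=\bar f_n$), $g_i^n:=g_{i+n-1}\circ\cdots\circ g_i$ for $n\ge1$, $g_i^0$ is the identity, and $g_i^{-n}:=(g_i^n)^{-1}$ (preimage). A transition matrix is a matrix $A=(a_{ij})_{N\times N}$, $N\ge2$, with $a_{ij}\in\{0,1\}$, $\sum_{j=1}^N a_{ij}\ge1$ for all $i$ and $\sum_{i=1}^N a_{ij}\ge1$ for all $j$. $\Sigma_N^+(A):=\{s=(s_0,s_1,\dots):1\le s_j\le N,\ a_{s_js_{j+1}}=1,\ j\ge0\}$.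 *)

theory Defs
  imports "HOL-Analysis.Analysis"
begin

definition compact_hyperspace :: "'a::metric_space set \<Rightarrow> 'a set set" where
  "compact_hyperspace X = {B. B \<noteq> {} \<and> B \<subseteq> X \<and> compact B}"

definition compact_subsets_within :: "'a::metric_space set \<Rightarrow> 'a set \<Rightarrow> 'a set set" where
  "compact_subsets_within X K = {B \<in> compact_hyperspace X. B \<subseteq> K}"

definition induced_maps :: "(nat \<Rightarrow> 'a \<Rightarrow> 'a) \<Rightarrow> nat \<Rightarrow> 'a set \<Rightarrow> 'a set" where
  "induced_maps f n B = f n ` B"

text \<open>
  \<open>nonaut_iter g i n\<close> is \<open>g (i + n - 1) \<circ> \<dots> \<circ> g i\<close>: the second argument is the
  starting time, the third is the number of steps.
\<close>

primrec nonaut_iter :: "(nat \<Rightarrow> 'b \<Rightarrow> 'b) \<Rightarrow> nat \<Rightarrow> nat \<Rightarrow> 'b \<Rightarrow> 'b" where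
  "nonaut_iter g i 0 = id"
| "nonaut_iter g i (Suc n) = g (i + n) \<circ> nonaut_iter g i n"

text \<open>
  The maps are total on the ambient type but only meant as self-maps of a carrier \<open>S\<close>,
  so preimages are taken inside \<open>S\<close>.
\<close>

definition nonaut_preimage ::
    "'b set \<Rightarrow> (nat \<Rightarrow> 'b \<Rightarrow> 'b) \<Rightarrow> nat \<Rightarrow> nat \<Rightarrow> 'b set \<Rightarrow> 'b set" where
  "nonaut_preimage S g i n U = nonaut_iter g i n -` U \<inter> S"

text \<open>Rows and columns are indexed by \<open>1, \<dots>, N\<close>; entries outside that range are irrelevant.\<close>

definition transition_matrix :: "nat \<Rightarrow> (nat \<Rightarrow> nat \<Rightarrow> nat) \<Rightarrow> bool" where
  "transition_matrix N A \<longleftrightarrow>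
     2 \<le> N \<and>
     (\<forall>i\<in>{1..N}. \<forall>j\<in>{1..N}. A i j \<in> {0, 1}) \<and>
     (\<forall>i\<in>{1..N}. (\<Sum>j=1..N. A i j) \<ge> 1) \<and>
     (\<forall>j\<in>{1..N}. (\<Sum>i=1..N. A i j) \<ge> 1)"

definition one_sided_subshift :: "nat \<Rightarrow> (nat \<Rightarrow> nat \<Rightarrow> nat) \<Rightarrow> (nat \<Rightarrow> nat) set" where
  "one_sided_subshift N A = {s. \<forall>j. 1 \<le> s j \<and> s j \<le> N \<and> A (s j) (s (Suc j)) = 1}"

definition V_itinerary ::
    "'a::metric_space set \<Rightarrow> (nat \<Rightarrow> 'a \<Rightarrow> 'a) \<Rightarrow> (nat \<Rightarrow> nat \<Rightarrow> 'a set) \<Rightarrow>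
     (nat \<Rightarrow> nat) \<Rightarrow> nat \<Rightarrow> nat \<Rightarrow> 'a set" where
  "V_itinerary X f V \<alpha> m n =
     (\<Inter>k\<in>{0..m}. nonaut_preimage X f n k (V (\<alpha> k) (n + k)))"

definition H_itinerary ::
    "'a::metric_space set \<Rightarrow> (nat \<Rightarrow> 'a \<Rightarrow> 'a) \<Rightarrow> (nat \<Rightarrow> nat \<Rightarrow> 'a set) \<Rightarrow>
     (nat \<Rightarrow> nat) \<Rightarrow> nat \<Rightarrow> nat \<Rightarrow> 'a set set" where
  "H_itinerary X f V \<alpha> m n =
     (\<Inter>k\<in>{0..m}. nonaut_preimage (compact_hyperspace X) (induced_maps f) n k
        (compact_subsets_within X (V (\<alpha> k) (n + k))))"

end

theory Submission
  imports Defs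
begin

text \<open>Iterating the induced maps is the same as taking images under the iterates of
  \<open>f\<close>, so a compact set follows the itinerary \<alpha> exactly when all its points do.
  A point of \<open>V_itinerary\<close> therefore yields its singleton in \<open>H_itinerary\<close>
  (\<open>singleton_in_H_itinerary\<close>), and any point of a member of \<open>H_itinerary\<close>
  lies in \<open>V_itinerary\<close> (\<open>H_itinerary_member_subset\<close>).\<close>

lemma nonaut_iter_induced_maps: "nonaut_iter (induced_maps f) i n B = nonaut_iter f i n ` B"
  by (induction n) (simp_all add: induced_maps_def image_comp)

text \<open>Supplies the condition in \<open>compact_hyperspace X\<close> that the images of a
  singleton stay inside \<open>X\<close>.\<close>

lemma nonaut_iter_in_carrier:
  assumes "\<And>k. f k \<in> X \<rightarrow> X" and "x \<in> X"
  shows "nonaut_iter f i n x \<in> X"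
  using assms by (induction n) auto

text \<open>The image of a singleton is again a singleton, hence nonempty and compact.\<close>

lemma singleton_in_H_itinerary:
  assumes "\<And>k. f k \<in> X \<rightarrow> X" and "x \<in> V_itinerary X f V \<alpha> m n"
  shows "{x} \<in> H_itinerary X f V \<alpha> m n"
proof -
  have x: "x \<in> X" "nonaut_iter f n k x \<in> V (\<alpha> k) (n + k)" if "k \<le> m" for k
    using assms(2) that by (auto simp: V_itinerary_def nonaut_preimage_def)
  then show ?thesis
    using nonaut_iter_in_carrier[OF assms(1)]
    by (auto simp: H_itinerary_def nonaut_preimage_def nonaut_iter_induced_maps
        compact_subsets_within_def compact_hyperspace_def)
qed

text \<open>The index range contains 0, so \<open>B\<close> lies in
  \<open>compact_hyperspace X\<close>, which makes it a nonempty subset of \<open>X\<close>. The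
  inclusion of each image of \<open>B\<close> in the prescribed set is then read off
  pointwise.\<close>

lemma H_itinerary_member_subset:
  assumes "B \<in> H_itinerary X f V \<alpha> m n"
  shows "B \<noteq> {}" and "B \<subseteq> V_itinerary X f V \<alpha> m n"
  using assms
  by (fastforce simp: H_itinerary_def V_itinerary_def nonaut_preimage_def
      nonaut_iter_induced_maps compact_subsets_within_def compact_hyperspace_def)+

theorem proposition4p2:
  fixes X :: "'a::metric_space set"
    and f :: "nat \<Rightarrow> 'a \<Rightarrow> 'a"
    and N :: nat
    and A :: "nat \<Rightarrow> nat \<Rightarrow> nat"
    and V :: "nat \<Rightarrow> nat \<Rightarrow> 'a set"
    and m n :: nat
    and \<alpha> :: "nat \<Rightarrow> nat"
  assumes "compact X"
    and "\<And>k. continuous_on X (f k)"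
    and "\<And>k. f k \<in> X \<rightarrow> X"
    and "transition_matrix N A"
    and "\<And>i k. i \<in> {1..N} \<Longrightarrow> V i k \<noteq> {}"
    and "\<And>i k. i \<in> {1..N} \<Longrightarrow> closedin (top_of_set X) (V i k)"
    and "\<alpha> \<in> one_sided_subshift N A"
  shows "V_itinerary X f V \<alpha> m n \<noteq> {} \<longleftrightarrow> H_itinerary X f V \<alpha> m n \<noteq> {}"
proof
  assume "V_itinerary X f V \<alpha> m n \<noteq> {}"
  then obtain x where "x \<in> V_itinerary X f V \<alpha> m n"
    by blast
  then have "{x} \<in> H_itinerary X f V \<alpha> m n"
    by (rule singleton_in_H_itinerary[OF assms(3)])
  then show "H_itinerary X f V \<alpha> m n \<noteq> {}"
    by blast
next
  assume "H_itinerary X f V \<alpha> m n \<noteq> {}"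
  then obtain B where "B \<in> H_itinerary X f V \<alpha> m n"
    by blast
  from H_itinerary_member_subset[OF this] show "V_itinerary X f V \<alpha> m n \<noteq> {}"
    by blast
qed

end
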